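(* Let $A \in \mathbb{R}^{m\times n}$ have rank $r$, let $1 \le k < r$, and let $A_k = U_k \Sigma_k V_k^T$ be the rank-$k$ truncated singular value decomposition of $A$. Let $b \in \mathbb{R}^m$, let $L$ be a real matrix with $n$ columns, and let $\lambda_1 > 0$, $\lambda_2 \ge 0$. Then the solution $\tilde{x} \in \mathbb{R}^n$ of the linear system $$(V_k \Sigma_k^2 V_k^T + \lambda_1 I + \lambda_2 L^T L)\,\tilde{x} = V_k \Sigma_k U_k^T b$$ is the same as the Tikhonov regularized solution of the projected system $(U_k^T A)x = U_k^T b$, that is, as $$\tilde{x}_2 = \arg\min_{x \in \mathbb{R}^n} \left\{ \|(U_k^T A)x - U_k^T b\|_2^2 + \lambda_1 \|x\|_2^2 + \lambda_2 \|Lx\|_2^2 \right\}.$$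
   Context: Write the singular value decomposition of $A \in \mathbb{R}^{m \times n}$ of rank $r$ as $A = \sum_{j=1}^{r} \sigma_j u_j v_j^T$ with $\sigma_1 \ge \sigma_2 \ge \dots \ge \sigma_r > 0$, where $u_1,\dots,u_r \in \mathbb{R}^m$ are orthonormal and $v_1,\dots,v_r \in \mathbb{R}^n$ are orthonormal. For $1 \le k < r$, set $U_k = [u_1 \cdots u_k] \in \mathbb{R}^{m\times k}$, $V_k = [v_1 \cdots v_k] \in \mathbb{R}^{n \times k}$, $\Sigma_k = \mathrm{Diag}(\sigma_1,\dots,\sigma_k)$, and $A_k = U_k \Sigma_k V_k^T$ (the truncated SVD). $\|\cdot\|_2$ is the Euclidean norm and $I$ is the identity matrix. *)

theory Defs
  imports "Jordan_Normal_Form.DL_Rank" "HOL-Analysis.L2_Norm"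
begin

definition vnorm2 :: "real vec \<Rightarrow> real"
  where "vnorm2 x = L2_set (\<lambda>i. x $ i) {..<dim_vec x}"

definition orthonormal_family :: "nat \<Rightarrow> nat \<Rightarrow> (nat \<Rightarrow> real vec) \<Rightarrow> bool"
  where "orthonormal_family d r w \<longleftrightarrow>
    (\<forall>i\<in>{1..r}. w i \<in> carrier_vec d) \<and>
    (\<forall>i\<in>{1..r}. \<forall>j\<in>{1..r}. w i \<bullet> w j = (if i = j then 1 else 0))"

(* The families sigma, u, v are indexed by 1..r; their values elsewhere are irrelevant.
   The last conjunct is A = (\<Sum>j=1..r. sigma_j u_j v_j^T), spelled out entrywise. *)
definition is_svd ::
  "nat \<Rightarrow> nat \<Rightarrow> nat \<Rightarrow> real mat \<Rightarrow> (nat \<Rightarrow> real) \<Rightarrow> (nat \<Rightarrow> real vec) \<Rightarrow> (nat \<Rightarrow> real vec) \<Rightarrow> bool"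
  where "is_svd m n r A \<sigma> u v \<longleftrightarrow>
    orthonormal_family m r u \<and> orthonormal_family n r v \<and>
    (\<forall>j\<in>{1..r}. \<sigma> j > 0) \<and>
    (\<forall>i\<in>{1..r}. \<forall>j\<in>{1..r}. i \<le> j \<longrightarrow> \<sigma> i \<ge> \<sigma> j) \<and>
    A = Matrix.mat m n (\<lambda>(p, q). \<Sum>j=1..r. \<sigma> j * (u j $ p) * (v j $ q))"

(* [w_1 ... w_k] as a d x k matrix *)
definition first_cols :: "nat \<Rightarrow> nat \<Rightarrow> (nat \<Rightarrow> real vec) \<Rightarrow> real mat"
  where "first_cols d k w = mat_of_cols d (map w [1..<k+1])"

(* Diag(sigma_1, ..., sigma_k); matrix indices start at 0, hence the shift *)
definition first_diag :: "nat \<Rightarrow> (nat \<Rightarrow> real) \<Rightarrow> real mat"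
  where "first_diag k \<sigma> = mat_diag k (\<lambda>i. \<sigma> (i + 1))"

end

theory Submission
  imports Defs
begin

text \<open>
  The statement combines two facts. First, orthonormality of the left singular vectors collapses
  the projected matrix: the product of \<open>Uk\<^sup>T\<close> with \<open>A = (\<Sum>j. \<sigma>\<^sub>j u\<^sub>j v\<^sub>j\<^sup>T)\<close> keeps only
  the first \<open>k\<close> terms of the sum, so \<open>Uk\<^sup>T A = Sk Vk\<^sup>T\<close>
  (\<open>transpose_first_cols_mult_svd\<close>). Hence, with \<open>M = Uk\<^sup>T A\<close> and \<open>c = Uk\<^sup>T b\<close>, the linear
  system is exactly the system of normal equations
  \<open>(M\<^sup>T M + \<lambda>\<^sub>1 I + \<lambda>\<^sub>2 L\<^sup>T L) x = M\<^sup>T c\<close> of the projected Tikhonov problem.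

  Second, for any \<open>M\<close> and \<open>c\<close> the Tikhonov objective is a quadratic polynomial in \<open>x\<close> whose
  Hessian is twice the matrix \<open>H\<close> of the normal equations. Expanding it about a
  solution \<open>x\<close> makes the linear term vanish, leaving \<open>J(x + d) = J(x) + d\<^sup>T H d\<close>
  (\<open>tikhonov_objective_add\<close>). Since \<open>\<lambda>\<^sub>1 > 0\<close>, the matrix \<open>H\<close> is positive definite
  (\<open>tikhonov_matrix_pos\<close>): the normal equations are solvable, and every solution
  is a strict global minimiser. A strict global minimiser is unique, so both solution sets are
  the same singleton (\<open>tikhonov_solution_sets\<close>).
\<close>

section \<open>The squared Euclidean norm\<close>

lemma vnorm2_square: "(vnorm2 x)\<^sup>2 = x \<bullet> x"
  by (simp add: vnorm2_def L2_set_def sum_nonneg scalar_prod_def power2_eq_square atLeast0LessThan)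

lemma scalar_prod_self_nonneg: "0 \<le> (x :: real vec) \<bullet> x"
  by (metis vnorm2_square zero_le_power2)

lemma scalar_prod_self_pos:
  fixes x :: "real vec"
  assumes "x \<in> carrier_vec n" and "x \<noteq> 0\<^sub>v n"
  shows "0 < x \<bullet> x"
proof -
  obtain i where i: "i < n" "x $ i \<noteq> 0"
    using assms by (metis carrier_vecD eq_vecI index_zero_vec)
  have "0 < (\<Sum>i\<in>{0..<n}. x $ i * x $ i)"
    by (rule sum_pos2[of _ i]) (use i in \<open>auto simp: zero_less_mult_iff\<close>)
  then show ?thesis using assms(1) by (simp add: scalar_prod_def)
qed

section \<open>Normal equations of Tikhonov regularization\<close>

definition tikhonov_matrix :: "real mat \<Rightarrow> real mat \<Rightarrow> real \<Rightarrow> real \<Rightarrow> real mat"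
  where "tikhonov_matrix M L \<alpha> \<beta> =
    transpose_mat M * M + \<alpha> \<cdot>\<^sub>m 1\<^sub>m (dim_col M) + \<beta> \<cdot>\<^sub>m (transpose_mat L * L)"

definition tikhonov_objective ::
  "real mat \<Rightarrow> real vec \<Rightarrow> real mat \<Rightarrow> real \<Rightarrow> real \<Rightarrow> real vec \<Rightarrow> real"
  where "tikhonov_objective M c L \<alpha> \<beta> x =
    (vnorm2 (M *\<^sub>v x - c))\<^sup>2 + \<alpha> * (vnorm2 x)\<^sup>2 + \<beta> * (vnorm2 (L *\<^sub>v x))\<^sup>2"

lemma tikhonov_matrix_carrier:
  assumes "M \<in> carrier_mat k n" and "L \<in> carrier_mat p n"
  shows "tikhonov_matrix M L \<alpha> \<beta> \<in> carrier_mat n n"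
  using assms unfolding tikhonov_matrix_def by auto

lemma smult_mult_mat_vec:
  assumes "B \<in> carrier_mat m n" and "x \<in> carrier_vec n"
  shows "(a \<cdot>\<^sub>m B) *\<^sub>v x = a \<cdot>\<^sub>v (B *\<^sub>v (x :: real vec))"
  using assms by (intro eq_vecI) auto

lemma scalar_prod_gram:
  assumes M: "M \<in> carrier_mat k n" and x: "x \<in> carrier_vec n" and d: "d \<in> carrier_vec n"
  shows "d \<bullet> ((transpose_mat M * M) *\<^sub>v x) = (M *\<^sub>v d) \<bullet> (M *\<^sub>v (x :: real vec))"
proof -
  have Mx: "M *\<^sub>v x \<in> carrier_vec k" and Md: "M *\<^sub>v d \<in> carrier_vec k"
    by (rule mult_mat_vec_carrier[OF M x], rule mult_mat_vec_carrier[OF M d])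
  have "d \<bullet> ((transpose_mat M * M) *\<^sub>v x) = d \<bullet> (transpose_mat M *\<^sub>v (M *\<^sub>v x))"
    using M x by (subst assoc_mult_mat_vec[of _ n k]) auto
  also have "\<dots> = (transpose_mat M *\<^sub>v (M *\<^sub>v x)) \<bullet> d"
    using M Mx d by (intro comm_scalar_prod[of _ n] mult_mat_vec_carrier[of _ n k]) auto
  also have "\<dots> = (M *\<^sub>v x) \<bullet> (M *\<^sub>v d)"
    by (rule transpose_vec_mult_scalar[OF M d Mx])
  finally show ?thesis using comm_scalar_prod[OF Mx Md] by simp
qed

lemma scalar_prod_tikhonov_matrix:
  assumes M: "M \<in> carrier_mat k n" and L: "L \<in> carrier_mat p n"
    and x: "x \<in> carrier_vec n" and d: "d \<in> carrier_vec n"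
  shows "d \<bullet> (tikhonov_matrix M L \<alpha> \<beta> *\<^sub>v x) =
    (M *\<^sub>v d) \<bullet> (M *\<^sub>v x) + \<alpha> * (d \<bullet> x) + \<beta> * ((L *\<^sub>v d) \<bullet> (L *\<^sub>v x))"
proof -
  have MM: "transpose_mat M * M \<in> carrier_mat n n"
    and LL: "transpose_mat L * L \<in> carrier_mat n n" using M L by auto
  have "tikhonov_matrix M L \<alpha> \<beta> *\<^sub>v x =
      (transpose_mat M * M) *\<^sub>v x + \<alpha> \<cdot>\<^sub>v x + \<beta> \<cdot>\<^sub>v ((transpose_mat L * L) *\<^sub>v x)"
    using MM LL M x
    by (simp add: tikhonov_matrix_def add_mult_distrib_mat_vec[of _ n n]
        smult_mult_mat_vec[of _ n n])
  moreover have "d \<bullet> \<dots> = d \<bullet> ((transpose_mat M * M) *\<^sub>v x) + \<alpha> * (d \<bullet> x)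
      + \<beta> * (d \<bullet> ((transpose_mat L * L) *\<^sub>v x))"
    using MM LL x d by (simp add: scalar_prod_add_distrib[of _ n])
  ultimately show ?thesis
    using scalar_prod_gram[OF M x d] scalar_prod_gram[OF L x d] by simp
qed

lemma tikhonov_matrix_pos:
  assumes M: "M \<in> carrier_mat k n" and L: "L \<in> carrier_mat p n"
    and "\<alpha> > 0" and "\<beta> \<ge> 0"
    and d: "d \<in> carrier_vec n" "d \<noteq> 0\<^sub>v n"
  shows "0 < d \<bullet> (tikhonov_matrix M L \<alpha> \<beta> *\<^sub>v d)"
proof -
  have "0 < \<alpha> * (d \<bullet> d)" using scalar_prod_self_pos[OF d] \<open>\<alpha> > 0\<close> by simp
  moreover have "0 \<le> \<beta> * ((L *\<^sub>v d) \<bullet> (L *\<^sub>v d))"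
    using scalar_prod_self_nonneg \<open>\<beta> \<ge> 0\<close> by simp
  ultimately show ?thesis
    using scalar_prod_self_nonneg[of "M *\<^sub>v d"]
    by (simp add: scalar_prod_tikhonov_matrix[OF M L d(1) d(1)])
qed

text \<open>A square matrix without kernel is invertible, and positivity of the quadratic form rules
  out a kernel.\<close>

lemma pos_quadratic_form_imp_solvable:
  fixes H :: "real mat"
  assumes H: "H \<in> carrier_mat n n"
    and pos: "\<And>d. d \<in> carrier_vec n \<Longrightarrow> d \<noteq> 0\<^sub>v n \<Longrightarrow> 0 < d \<bullet> (H *\<^sub>v d)"
    and g: "g \<in> carrier_vec n"
  obtains x where "x \<in> carrier_vec n" and "H *\<^sub>v x = g"
proof -
  have "det H \<noteq> 0"
    using pos unfolding det_0_iff_vec_prod_zero[OF H] by (metis less_irrefl scalar_prod_right_zero)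
  from det_non_zero_imp_unit[OF H this, of "()"]
  obtain B where B: "B \<in> carrier_mat n n" "H * B = 1\<^sub>m n"
    unfolding Units_def ring_mat_def by auto
  have "H *\<^sub>v (B *\<^sub>v g) = g"
    using assoc_mult_mat_vec[OF H B(1) g] B(2) g by simp
  then show thesis using that[of "B *\<^sub>v g"] B(1) g by auto
qed

lemma scalar_prod_add_self:
  assumes "x \<in> carrier_vec n" and "y \<in> carrier_vec n"
  shows "(x + y) \<bullet> (x + y) = x \<bullet> x + 2 * (y \<bullet> x) + y \<bullet> (y :: real vec)"
  using assms comm_scalar_prod[OF assms]
  by (simp add: add_scalar_prod_distrib[of _ n] scalar_prod_add_distrib[of _ n])

text \<open>The second-order Taylor expansion of the objective, exact because it is quadratic. The term
  linear in \<open>d\<close> is twice \<open>d \<bullet> (H x - M\<^sup>T c)\<close>, which the normal equations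
  annihilate.\<close>

lemma tikhonov_objective_add:
  assumes M: "M \<in> carrier_mat k n" and L: "L \<in> carrier_mat p n" and c: "c \<in> carrier_vec k"
    and x: "x \<in> carrier_vec n" and d: "d \<in> carrier_vec n"
    and normal: "tikhonov_matrix M L \<alpha> \<beta> *\<^sub>v x = transpose_mat M *\<^sub>v c"
  shows "tikhonov_objective M c L \<alpha> \<beta> (x + d) =
    tikhonov_objective M c L \<alpha> \<beta> x + d \<bullet> (tikhonov_matrix M L \<alpha> \<beta> *\<^sub>v d)"
proof -
  have Mx: "M *\<^sub>v x \<in> carrier_vec k" and Md: "M *\<^sub>v d \<in> carrier_vec k"
    and Lx: "L *\<^sub>v x \<in> carrier_vec p" and Ld: "L *\<^sub>v d \<in> carrier_vec p"
    using M L x d by (blast intro: mult_mat_vec_carrier)+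
  have res: "M *\<^sub>v x - c \<in> carrier_vec k" using Mx c by auto
  have "M *\<^sub>v (x + d) - c = (M *\<^sub>v x - c) + M *\<^sub>v d"
    unfolding mult_add_distrib_mat_vec[OF M x d] using Mx Md c
    by (intro eq_vecI) (simp_all del: index_mult_mat_vec dim_mult_mat_vec)
  moreover have "L *\<^sub>v (x + d) = L *\<^sub>v x + L *\<^sub>v d"
    by (rule mult_add_distrib_mat_vec[OF L x d])
  ultimately have "tikhonov_objective M c L \<alpha> \<beta> (x + d) = tikhonov_objective M c L \<alpha> \<beta> x
      + 2 * ((M *\<^sub>v d) \<bullet> (M *\<^sub>v x - c) + \<alpha> * (d \<bullet> x) + \<beta> * ((L *\<^sub>v d) \<bullet> (L *\<^sub>v x)))
      + ((M *\<^sub>v d) \<bullet> (M *\<^sub>v d) + \<alpha> * (d \<bullet> d) + \<beta> * ((L *\<^sub>v d) \<bullet> (L *\<^sub>v d)))"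
    unfolding tikhonov_objective_def vnorm2_square
    by (simp add: scalar_prod_add_self[OF res Md] scalar_prod_add_self[OF x d]
        scalar_prod_add_self[OF Lx Ld] algebra_simps)
  moreover have "(M *\<^sub>v d) \<bullet> (M *\<^sub>v x - c) + \<alpha> * (d \<bullet> x) + \<beta> * ((L *\<^sub>v d) \<bullet> (L *\<^sub>v x)) = 0"
  proof -
    have "(M *\<^sub>v d) \<bullet> c = c \<bullet> (M *\<^sub>v d)" by (rule comm_scalar_prod[OF Md c])
    also have "\<dots> = (transpose_mat M *\<^sub>v c) \<bullet> d"
      by (rule transpose_vec_mult_scalar[OF M d c, symmetric])
    also have "\<dots> = d \<bullet> (transpose_mat M *\<^sub>v c)"
      using M c d by (intro comm_scalar_prod[of _ n] mult_mat_vec_carrier[of _ n k]) auto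
    also have "\<dots> = (M *\<^sub>v d) \<bullet> (M *\<^sub>v x) + \<alpha> * (d \<bullet> x) + \<beta> * ((L *\<^sub>v d) \<bullet> (L *\<^sub>v x))"
      unfolding normal[symmetric] by (rule scalar_prod_tikhonov_matrix[OF M L x d])
    finally show ?thesis by (simp add: scalar_prod_minus_distrib[OF Md Mx c])
  qed
  ultimately show ?thesis by (simp add: scalar_prod_tikhonov_matrix[OF M L d d])
qed

lemma normal_equations_imp_strict_minimum:
  assumes M: "M \<in> carrier_mat k n" and L: "L \<in> carrier_mat p n" and c: "c \<in> carrier_vec k"
    and "\<alpha> > 0" and "\<beta> \<ge> 0"
    and x: "x \<in> carrier_vec n" and y: "y \<in> carrier_vec n" and "y \<noteq> x"
    and normal: "tikhonov_matrix M L \<alpha> \<beta> *\<^sub>v x = transpose_mat M *\<^sub>v c"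
  shows "tikhonov_objective M c L \<alpha> \<beta> x < tikhonov_objective M c L \<alpha> \<beta> y"
proof -
  have d: "y - x \<in> carrier_vec n" and xd: "x + (y - x) = y" using x y by auto
  have "y - x \<noteq> 0\<^sub>v n" using xd x \<open>y \<noteq> x\<close> by auto
  from tikhonov_matrix_pos[OF M L \<open>\<alpha> > 0\<close> \<open>\<beta> \<ge> 0\<close> d this]
    tikhonov_objective_add[OF M L c x d normal]
  show ?thesis by (simp add: xd)
qed

text \<open>The linear system inherits its uniqueness from the objective: two distinct solutions would
  each have a strictly smaller objective value than the other.\<close>

lemma tikhonov_solution_sets:
  assumes M: "M \<in> carrier_mat k n" and L: "L \<in> carrier_mat p n" and c: "c \<in> carrier_vec k"
    and pos: "\<alpha> > 0" "\<beta> \<ge> 0"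
  obtains xt where "xt \<in> carrier_vec n"
    and "{x \<in> carrier_vec n. tikhonov_matrix M L \<alpha> \<beta> *\<^sub>v x = transpose_mat M *\<^sub>v c} = {xt}"
    and "{x. is_arg_min (tikhonov_objective M c L \<alpha> \<beta>) (\<lambda>x. x \<in> carrier_vec n) x} = {xt}"
proof -
  have "transpose_mat M *\<^sub>v c \<in> carrier_vec n"
    using M c by (intro mult_mat_vec_carrier[of _ n k]) auto
  from pos_quadratic_form_imp_solvable[OF tikhonov_matrix_carrier[OF M L]
      tikhonov_matrix_pos[OF M L pos] this]
  obtain xt where xt: "xt \<in> carrier_vec n"
    and normal: "tikhonov_matrix M L \<alpha> \<beta> *\<^sub>v xt = transpose_mat M *\<^sub>v c" .
  note strict = normal_equations_imp_strict_minimum[OF M L c pos]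
  have "x = xt" if "x \<in> carrier_vec n" "tikhonov_matrix M L \<alpha> \<beta> *\<^sub>v x = transpose_mat M *\<^sub>v c" for x
  proof (rule ccontr)
    assume "x \<noteq> xt"
    with strict[OF that(1) xt _ that(2)] strict[OF xt that(1) _ normal] show False by simp
  qed
  then have system: "{x \<in> carrier_vec n. tikhonov_matrix M L \<alpha> \<beta> *\<^sub>v x = transpose_mat M *\<^sub>v c} = {xt}"
    using xt normal by blast
  have "is_arg_min (tikhonov_objective M c L \<alpha> \<beta>) (\<lambda>x. x \<in> carrier_vec n) x \<longleftrightarrow> x = xt" for x
  proof -
    have less: "tikhonov_objective M c L \<alpha> \<beta> xt < tikhonov_objective M c L \<alpha> \<beta> y"
      if "y \<in> carrier_vec n" "y \<noteq> xt" for y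
      by (rule strict[OF xt that normal])
    show ?thesis unfolding is_arg_min_def using less xt by (metis less_asym less_irrefl)
  qed
  then show thesis using that[OF xt system] by simp
qed

section \<open>Projection onto the leading left singular vectors\<close>

lemma first_cols_carrier: "first_cols d k w \<in> carrier_mat d k"
  using mat_of_cols_carrier(1)[of d "map w [1..<k+1]"] by (simp add: first_cols_def del: upt_Suc)

lemma first_cols_index: "i < d \<Longrightarrow> j < k \<Longrightarrow> first_cols d k w $$ (i, j) = w (j + 1) $ i"
  by (simp add: first_cols_def mat_of_cols_index del: upt_Suc)

text \<open>Row \<open>i\<close> of the product pairs \<open>u\<^sub>i\<^sub>+\<^sub>1\<close> with every \<open>u\<^sub>j\<close>, and orthonormality leaves only
  the summand \<open>j = i + 1\<close>.\<close>

lemma transpose_first_cols_mult_svd: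
  assumes svd: "is_svd m n r A \<sigma> u v" and "k \<le> r"
  shows "transpose_mat (first_cols m k u) * A = first_diag k \<sigma> * transpose_mat (first_cols n k v)"
    (is "?P = ?Q")
proof (rule eq_matI)
  have A: "A = Matrix.mat m n (\<lambda>(p, q). \<Sum>j=1..r. \<sigma> j * (u j $ p) * (v j $ q))"
    and u: "orthonormal_family m r u"
    using svd by (auto simp: is_svd_def)
  note U = first_cols_carrier[of m k u] and V = first_cols_carrier[of n k v]
  have Q: "?Q = Matrix.mat k n (\<lambda>(i, q). \<sigma> (i + 1) * transpose_mat (first_cols n k v) $$ (i, q))"
    unfolding first_diag_def using V by (intro mat_diag_mult_left) auto
  show "dim_row ?P = dim_row ?Q" and "dim_col ?P = dim_col ?Q"
    using U V by (auto simp: A Q)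
  fix i q assume "i < dim_row ?Q" and "q < dim_col ?Q"
  then have i: "i < k" and q: "q < n" by (auto simp: Q)
  have orth: "(\<Sum>p<m. u (i + 1) $ p * u j $ p) = (if i + 1 = j then 1 else 0)"
    if "j \<in> {1..r}" for j
  proof -
    have "i + 1 \<in> {1..r}" and "u j \<in> carrier_vec m"
      using u that i \<open>k \<le> r\<close> by (auto simp: orthonormal_family_def)
    moreover from this(1) have "u (i + 1) \<bullet> u j = (if i + 1 = j then 1 else 0)"
      using u that unfolding orthonormal_family_def by blast
    ultimately show ?thesis
      by (simp add: scalar_prod_def atLeast0LessThan)
  qed
  have "?P $$ (i, q) = (\<Sum>p<m. u (i + 1) $ p * (\<Sum>j=1..r. \<sigma> j * u j $ p * v j $ q))"
    using U i q by (simp add: A scalar_prod_def first_cols_index atLeast0LessThan)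
  also have "\<dots> = (\<Sum>j=1..r. (\<Sum>p<m. u (i + 1) $ p * u j $ p) * (\<sigma> j * v j $ q))"
    unfolding sum_distrib_left sum_distrib_right
    by (subst sum.swap) (simp add: mult_ac)
  also have "\<dots> = (\<Sum>j=1..r. if i + 1 = j then \<sigma> j * v j $ q else 0)"
    by (rule sum.cong) (use orth in auto)
  also have "\<dots> = \<sigma> (i + 1) * v (i + 1) $ q"
    using i \<open>k \<le> r\<close> by simp
  also have "\<dots> = ?Q $$ (i, q)"
    using V i q by (simp add: Q first_cols_index)
  finally show "?P $$ (i, q) = ?Q $$ (i, q)" .
qed

lemma transpose_mat_diag: "transpose_mat (mat_diag k f) = mat_diag k f"
  by (rule eq_matI) (auto simp: mat_diag_def)

theorem lemma5p2:
  fixes m n r k p :: nat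
    and A Ak Uk Vk Sk L :: "real mat"
    and \<sigma> :: "nat \<Rightarrow> real"
    and u v :: "nat \<Rightarrow> real vec"
    and b :: "real vec"
    and lam1 lam2 :: real
  assumes "A \<in> carrier_mat m n"
    and "vec_space.rank m A = r"
    and "is_svd m n r A \<sigma> u v"
    and "1 \<le> k" and "k < r"
    and "Uk = first_cols m k u"
    and "Vk = first_cols n k v"
    and "Sk = first_diag k \<sigma>"
    and "Ak = Uk * Sk * transpose_mat Vk"
    and "b \<in> carrier_vec m"
    and "L \<in> carrier_mat p n"
    and "lam1 > 0" and "lam2 \<ge> 0"
  shows "\<exists>xt \<in> carrier_vec n.
    {x \<in> carrier_vec n.
       (Vk * (Sk ^\<^sub>m 2) * transpose_mat Vk + lam1 \<cdot>\<^sub>m 1\<^sub>m n + lam2 \<cdot>\<^sub>m (transpose_mat L * L)) *\<^sub>v x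
         = (Vk * Sk * transpose_mat Uk) *\<^sub>v b} = {xt} \<and>
    {x. is_arg_min
          (\<lambda>x. (vnorm2 ((transpose_mat Uk * A) *\<^sub>v x - transpose_mat Uk *\<^sub>v b))\<^sup>2
                + lam1 * (vnorm2 x)\<^sup>2 + lam2 * (vnorm2 (L *\<^sub>v x))\<^sup>2)
          (\<lambda>x. x \<in> carrier_vec n) x} = {xt}"
proof -
  note U = first_cols_carrier[of m k u, folded assms(6)]
    and V = first_cols_carrier[of n k v, folded assms(7)]
  have S: "Sk \<in> carrier_mat k k" and St: "transpose_mat Sk = Sk"
    unfolding assms(8) first_diag_def by (simp_all add: transpose_mat_diag)
  define M where "M = transpose_mat Uk * A"
  define c where "c = transpose_mat Uk *\<^sub>v b"
  have M: "M \<in> carrier_mat k n" and c: "c \<in> carrier_vec k"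
    using U assms(1,10) by (auto simp: M_def c_def intro!: mult_mat_vec_carrier[of _ k m])
  have M_eq: "M = Sk * transpose_mat Vk"
    unfolding M_def assms(6-8) using assms(3,5) by (intro transpose_first_cols_mult_svd) auto
  have Mt: "transpose_mat M = Vk * Sk"
    unfolding M_eq using transpose_mult[OF S, of "transpose_mat Vk" n] V St by simp
  have "transpose_mat M * M = Vk * Sk * (Sk * transpose_mat Vk)"
    by (simp only: Mt) (simp only: M_eq)
  also have "\<dots> = Vk * (Sk * Sk) * transpose_mat Vk"
    using V S by (simp add: assoc_mult_mat[of _ n k _ k _ n] assoc_mult_mat[of _ n k _ k _ k]
        assoc_mult_mat[of _ k k _ k _ n])
  also have "Sk * Sk = Sk ^\<^sub>m 2"
    using S by (simp add: numeral_2_eq_2)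
  finally have "transpose_mat M * M = Vk * (Sk ^\<^sub>m 2) * transpose_mat Vk" .
  then have H: "Vk * (Sk ^\<^sub>m 2) * transpose_mat Vk + lam1 \<cdot>\<^sub>m 1\<^sub>m n
      + lam2 \<cdot>\<^sub>m (transpose_mat L * L) = tikhonov_matrix M L lam1 lam2"
    using M by (simp add: tikhonov_matrix_def)
  have g: "(Vk * Sk * transpose_mat Uk) *\<^sub>v b = transpose_mat M *\<^sub>v c"
    unfolding Mt c_def using U V S assms(10)
    by (intro assoc_mult_mat_vec[of _ n k _ m]) auto
  have J: "(\<lambda>x. (vnorm2 ((transpose_mat Uk * A) *\<^sub>v x - transpose_mat Uk *\<^sub>v b))\<^sup>2
      + lam1 * (vnorm2 x)\<^sup>2 + lam2 * (vnorm2 (L *\<^sub>v x))\<^sup>2) = tikhonov_objective M c L lam1 lam2"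
    by (simp add: tikhonov_objective_def M_def c_def fun_eq_iff)
  obtain xt where "xt \<in> carrier_vec n"
    and "{x \<in> carrier_vec n. tikhonov_matrix M L lam1 lam2 *\<^sub>v x = transpose_mat M *\<^sub>v c} = {xt}"
    and "{x. is_arg_min (tikhonov_objective M c L lam1 lam2) (\<lambda>x. x \<in> carrier_vec n) x} = {xt}"
    using tikhonov_solution_sets[OF M assms(11) c assms(12,13)] .
  then show ?thesis unfolding H g J by blast
qed

end
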